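(* Let $a,b\in\mathbb{Z}\setminus\{0\}$. The Diophantine equation $a(x^2-y^6)=b(z^6-w^6)$ has infinitely many non-trivial solutions in coprime polynomials $x,y,z,w\in\mathbb{Z}[t]$. Moreover, the set of rational points on the surface $S:\;a(x^2-y^6)=b(z^6-w^6)$ is dense in the set of real points of $S$ in the Euclidean topology.
   Context: A solution is called trivial if both sides of the equation vanish separately for trivial reasons (e.g. $x^2=y^6$ and $z^6=w^6$), representing lines and curves on the surface; such trivial solutions are discarded and only non-trivial solutions are counted. "Coprime polynomials" means $\gcd(x,y,z,w)=1$ in $\mathbb{Z}[t]$. *)

theory Defs
  imports "HOL-Analysis.Analysis" "HOL-Computational_Algebra.Polynomial_Factorial"
begin

text \<open>The equation is stated over an arbitrary commutative ring, so that the same predicate is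
  used over the polynomial ring, over the rationals and over the reals.\<close>

definition solves_eqn :: "int \<Rightarrow> int \<Rightarrow> 'a::comm_ring_1 \<times> 'a \<times> 'a \<times> 'a \<Rightarrow> bool" where
  "solves_eqn a b = (\<lambda>(x, y, z, w).
     of_int a * (x ^ 2 - y ^ 6) = of_int b * (z ^ 6 - w ^ 6))"

definition trivial_sol :: "int \<Rightarrow> int \<Rightarrow> 'a::comm_ring_1 \<times> 'a \<times> 'a \<times> 'a \<Rightarrow> bool" where
  "trivial_sol a b = (\<lambda>(x, y, z, w).
     of_int a * (x ^ 2 - y ^ 6) = 0 \<and> of_int b * (z ^ 6 - w ^ 6) = 0)"

text \<open>The equation is homogeneous of degree 6 for the weights 3, 1, 1, 1 of x, y, z, w and thus
  defines a surface in the weighted projective space P(3,1,1,1). Only points with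
  (y, z, w) nonzero lie on the surface, and such a point is real (rational) iff it has a real
  (rational) coordinate vector, since one of y, z, w can be scaled to 1.
  The real locus is represented by the orbits of nonzero real vectors under the weighted action
  of the nonzero reals, with the quotient of the Euclidean topology.\<close>

type_synonym real4 = "real \<times> real \<times> real \<times> real"

definition wscale :: "real \<Rightarrow> real4 \<Rightarrow> real4" where
  "wscale c = (\<lambda>(x, y, z, w). (c ^ 3 * x, c * y, c * z, c * w))"

definition wpoint :: "real4 \<Rightarrow> real4 set" where
  "wpoint v = {wscale c v | c. c \<noteq> 0}"

definition wproj_space :: "real4 set set" where
  "wproj_space = wpoint ` (- {0})"

definition wproj_topology :: "real4 set topology" where
  "wproj_topology =
     topology (\<lambda>U. U \<subseteq> wproj_space \<and> open {v. v \<noteq> 0 \<and> wpoint v \<in> U})"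

definition real4_of_rat :: "rat \<times> rat \<times> rat \<times> rat \<Rightarrow> real4" where
  "real4_of_rat = (\<lambda>(x, y, z, w). (of_rat x, of_rat y, of_rat z, of_rat w))"

definition real_points :: "int \<Rightarrow> int \<Rightarrow> real4 set set" where
  "real_points a b = {wpoint v | v. v \<noteq> 0 \<and> solves_eqn a b v}"

definition rational_points :: "int \<Rightarrow> int \<Rightarrow> real4 set set" where
  "rational_points a b = {wpoint (real4_of_rat r) | r. r \<noteq> 0 \<and> solves_eqn a b r}"

lemma openin_wproj_topology:
  "openin wproj_topology U \<longleftrightarrow>
     U \<subseteq> wproj_space \<and> open {v. v \<noteq> 0 \<and> wpoint v \<in> U}"
proof -
  have "istopology (\<lambda>U. U \<subseteq> wproj_space \<and> open {v. v \<noteq> 0 \<and> wpoint v \<in> U})"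
    unfolding istopology_def
  proof (intro conjI allI impI)
    fix S T
    assume S: "S \<subseteq> wproj_space \<and> open {v. v \<noteq> 0 \<and> wpoint v \<in> S}"
      and T: "T \<subseteq> wproj_space \<and> open {v. v \<noteq> 0 \<and> wpoint v \<in> T}"
    show "S \<inter> T \<subseteq> wproj_space" using S by blast
    have "{v. v \<noteq> 0 \<and> wpoint v \<in> S \<inter> T} =
        {v. v \<noteq> 0 \<and> wpoint v \<in> S} \<inter> {v. v \<noteq> 0 \<and> wpoint v \<in> T}"
      by blast
    then show "open {v. v \<noteq> 0 \<and> wpoint v \<in> S \<inter> T}"
      using S T by (simp add: open_Int)
  next
    fix K
    assume K: "\<forall>U\<in>K. U \<subseteq> wproj_space \<and> open {v. v \<noteq> 0 \<and> wpoint v \<in> U}"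
    show "\<Union>K \<subseteq> wproj_space" using K by blast
    have "{v. v \<noteq> 0 \<and> wpoint v \<in> \<Union>K} = (\<Union>U\<in>K. {v. v \<noteq> 0 \<and> wpoint v \<in> U})"
      by blast
    then show "open {v. v \<noteq> 0 \<and> wpoint v \<in> \<Union>K}"
      using K by (metis (mono_tags, lifting) open_UN)
  qed
  then show ?thesis
    by (simp add: wproj_topology_def topology_inverse')
qed

lemma topspace_wproj_topology: "topspace wproj_topology = wproj_space"
proof
  show "topspace wproj_topology \<subseteq> wproj_space"
    using openin_topspace[of wproj_topology] openin_wproj_topology by blast
  have "{v. v \<noteq> 0 \<and> wpoint v \<in> wproj_space} = - {0}"
    by (auto simp: wproj_space_def)
  then have "openin wproj_topology wproj_space"
    by (simp add: openin_wproj_topology open_Compl)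
  then show "wproj_space \<subseteq> topspace wproj_topology"
    by (rule openin_subset)
qed

lemma wscale_1 [simp]: "wscale 1 v = v"
  by (simp add: wscale_def split: prod.splits)

lemma wscale_wscale: "wscale c (wscale d v) = wscale (c * d) v"
  by (simp add: wscale_def power_mult_distrib split: prod.splits)

lemma wscale_eq_0_iff: "c \<noteq> 0 \<Longrightarrow> wscale c v = 0 \<longleftrightarrow> v = 0"
  by (auto simp: wscale_def zero_prod_def split: prod.splits)

lemma wpoint_self: "v \<in> wpoint v"
  unfolding wpoint_def by (auto intro!: exI[of _ 1])

lemma wpoint_eq_iff: "wpoint u = wpoint v \<longleftrightarrow> (\<exists>c. c \<noteq> 0 \<and> u = wscale c v)"
proof
  assume "wpoint u = wpoint v"
  then show "\<exists>c. c \<noteq> 0 \<and> u = wscale c v"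
    using wpoint_self[of u] by (auto simp: wpoint_def)
next
  assume "\<exists>c. c \<noteq> 0 \<and> u = wscale c v"
  then obtain c where c: "c \<noteq> 0" "u = wscale c v" by blast
  have "wscale d v = wscale (d / c) u" for d
    using c by (simp add: wscale_wscale)
  then have "\<exists>d'. wscale d v = wscale d' u \<and> d' \<noteq> 0" if "d \<noteq> 0" for d
    using that c by (metis divide_eq_0_iff)
  moreover have "\<exists>d'. wscale d u = wscale d' v \<and> d' \<noteq> 0" if "d \<noteq> 0" for d
    using that c by (auto simp: wscale_wscale intro!: exI[of _ "d * c"])
  ultimately show "wpoint u = wpoint v"
    unfolding wpoint_def by auto
qed

lemma solves_eqn_wscale: "solves_eqn a b v \<Longrightarrow> solves_eqn a b (wscale c v)"
proof -
  assume "solves_eqn a b v"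
  obtain x y z w where v: "v = (x, y, z, w)" by (cases v)
  have "of_int a * ((c^3*x)^2 - (c*y)^6) = c^6 * (of_int a * (x^2 - y^6))"
    by (simp add: power_mult_distrib algebra_simps flip: power_mult)
  moreover have "of_int b * ((c*z)^6 - (c*w)^6) = c^6 * (of_int b * (z^6 - w^6))"
    by (simp add: power_mult_distrib algebra_simps)
  ultimately show ?thesis
    using \<open>solves_eqn a b v\<close> unfolding v solves_eqn_def wscale_def split by metis
qed

lemma real4_of_rat_eq_0_iff [simp]: "real4_of_rat r = 0 \<longleftrightarrow> r = 0"
  by (auto simp: real4_of_rat_def zero_prod_def split: prod.splits)

lemma solves_eqn_real4_of_rat: "solves_eqn a b (real4_of_rat r) \<longleftrightarrow> solves_eqn a b r"
proof -
  obtain x y z w where r: "r = (x, y, z, w)" by (cases r)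
  have "(of_int a * (of_rat x ^ 2 - of_rat y ^ 6) :: real) = of_rat (of_int a * (x ^ 2 - y ^ 6))"
    "(of_int b * (of_rat z ^ 6 - of_rat w ^ 6) :: real) = of_rat (of_int b * (z ^ 6 - w ^ 6))"
    by (simp_all add: of_rat_mult of_rat_diff of_rat_power)
  then show ?thesis
    by (simp add: r solves_eqn_def real4_of_rat_def)
qed

lemma rational_points_subset: "rational_points a b \<subseteq> real_points a b"
proof
  fix p assume "p \<in> rational_points a b"
  then obtain r where "r \<noteq> 0" "solves_eqn a b r" "p = wpoint (real4_of_rat r)"
    by (auto simp: rational_points_def)
  then show "p \<in> real_points a b"
    unfolding real_points_def using solves_eqn_real4_of_rat real4_of_rat_eq_0_iff by blast
qed

lemma real_points_subset: "real_points a b \<subseteq> wproj_space"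
  by (auto simp: real_points_def wproj_space_def)

lemma wpoint_in_real_points_iff:
  "v \<noteq> 0 \<Longrightarrow> wpoint v \<in> real_points a b \<longleftrightarrow> solves_eqn a b v"
proof
  assume "wpoint v \<in> real_points a b"
  then obtain u where u: "wpoint v = wpoint u" "solves_eqn a b u"
    by (auto simp: real_points_def)
  then obtain c where "v = wscale c u"
    unfolding wpoint_eq_iff by auto
  then show "solves_eqn a b v" using u solves_eqn_wscale by simp
next
  assume "solves_eqn a b v"
  then show "wpoint v \<in> real_points a b" if "v \<noteq> 0"
    unfolding real_points_def using that by blast
qed

text \<open>Density on the surface is the same as density on the affine cone over it.\<close>

lemma dense_iff_dense_cone:
  "subtopology wproj_topology (real_points a b) closure_of rational_points a b = real_points a b
   \<longleftrightarrow> {v. solves_eqn a b v} \<subseteq> closure (real4_of_rat ` {r. solves_eqn a b r})"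
  (is "?L \<longleftrightarrow> ?R")
proof -
  have "?L \<longleftrightarrow> real_points a b \<subseteq> wproj_topology closure_of rational_points a b"
    using rational_points_subset[of a b]
    by (auto simp: closure_of_subtopology Int_absorb1)
  also have "\<dots> \<longleftrightarrow> ?R"
  proof
    assume L: "real_points a b \<subseteq> wproj_topology closure_of rational_points a b"
    show ?R
    proof (intro subsetI)
      fix v :: real4 assume "v \<in> {v. solves_eqn a b v}"
      then have v: "solves_eqn a b v" by simp
      show "v \<in> closure (real4_of_rat ` {r. solves_eqn a b r})"
      proof (cases "v = 0")
        case True
        then have "v = real4_of_rat 0" by simp
        moreover have "solves_eqn a b (0 :: rat \<times> rat \<times> rat \<times> rat)"
          by (simp add: solves_eqn_def zero_prod_def)
        ultimately have "v \<in> real4_of_rat ` {r. solves_eqn a b r}"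
          by (metis imageI mem_Collect_eq)
        then show ?thesis by (rule subsetD[OF closure_subset])
      next
        case False
        show ?thesis
          unfolding closure_iff_nhds_not_empty
        proof (intro allI impI)
          fix A N :: "real4 set"
          assume N: "N \<subseteq> A" "open N" "v \<in> N"
          define U where "U = wpoint ` (N - {0})"
          have eq: "{u. u \<noteq> 0 \<and> wpoint u \<in> U} = (\<Union>c\<in>-{0}. wscale c -` (N - {0}))"
          proof (intro set_eqI iffI)
            fix u assume "u \<in> {u. u \<noteq> 0 \<and> wpoint u \<in> U}"
            then obtain n where n: "n \<in> N - {0}" "wpoint n = wpoint u"
              unfolding U_def by (metis (no_types, lifting) imageE mem_Collect_eq)
            then obtain c where "c \<noteq> 0" "n = wscale c u"
              using wpoint_eq_iff by blast
            then show "u \<in> (\<Union>c\<in>-{0}. wscale c -` (N - {0}))" using n by auto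
          next
            fix u assume "u \<in> (\<Union>c\<in>-{0}. wscale c -` (N - {0}))"
            then obtain c where c: "c \<noteq> 0" "wscale c u \<in> N - {0}" by auto
            then have "wpoint (wscale c u) = wpoint u" using wpoint_eq_iff by blast
            then have "wpoint u \<in> U" using c(2) unfolding U_def by (metis imageI)
            moreover have "u \<noteq> 0" using c wscale_eq_0_iff by auto
            ultimately show "u \<in> {u. u \<noteq> 0 \<and> wpoint u \<in> U}" by simp
          qed
          have cont: "continuous_on UNIV (wscale c)" for c
            unfolding wscale_def case_prod_unfold by (intro continuous_intros)
          have "open (wscale c -` (N - {0}))" for c
            using cont N(2) by (intro open_vimage) (auto intro: open_delete)
          then have "open {u. u \<noteq> 0 \<and> wpoint u \<in> U}"
            unfolding eq by (intro open_UN ballI)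
          moreover have "U \<subseteq> wproj_space" by (auto simp: U_def wproj_space_def)
          ultimately have "openin wproj_topology U" by (simp add: openin_wproj_topology)
          moreover have "wpoint v \<in> U" using N False by (auto simp: U_def)
          moreover have "wpoint v \<in> wproj_topology closure_of rational_points a b"
            using L v wpoint_in_real_points_iff[OF False] by (meson subsetD)
          ultimately obtain p where "p \<in> rational_points a b" "p \<in> U"
            by (auto simp: in_closure_of)
          moreover from \<open>p \<in> U\<close> obtain n where n: "n \<in> N" and "p = wpoint n"
            unfolding U_def by (metis DiffD1 imageE)
          ultimately obtain r where r: "solves_eqn a b r"
            and "wpoint n = wpoint (real4_of_rat r)"
            by (auto simp: rational_points_def)
          then obtain c where c: "n = wscale c (real4_of_rat r)"
            using wpoint_eq_iff by blast
          define M where "M = (\<lambda>d. wscale d (real4_of_rat r)) -` N"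
          have "continuous_on UNIV (\<lambda>d. wscale d (real4_of_rat r))"
            unfolding wscale_def case_prod_unfold by (intro continuous_intros)
          then have "open M" unfolding M_def using N(2) by (intro open_vimage)
          moreover have "c \<in> M" using c n by (simp add: M_def)
          ultimately obtain e where e: "e > 0" "\<forall>d. dist d c < e \<longrightarrow> d \<in> M"
            by (auto simp: open_dist)
          obtain q where q: "c < of_rat q" "of_rat q < c + e"
            using of_rat_dense[of c "c + e"] e(1) by auto
          then have "of_rat q \<in> M" using e(2) by (auto simp: dist_real_def)
          then have inN: "wscale (of_rat q) (real4_of_rat r) \<in> N" by (simp add: M_def)
          obtain x y z w where xyzw: "r = (x, y, z, w)" by (cases r)
          have sc: "wscale (of_rat q) (real4_of_rat r) =
              real4_of_rat (q ^ 3 * x, q * y, q * z, q * w)"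
            by (simp add: xyzw wscale_def real4_of_rat_def of_rat_mult of_rat_power)
          have "solves_eqn a b (q ^ 3 * x, q * y, q * z, q * w)"
            using r solves_eqn_wscale sc solves_eqn_real4_of_rat by metis
          then have "wscale (of_rat q) (real4_of_rat r) \<in> real4_of_rat ` {r. solves_eqn a b r}"
            unfolding sc by (intro imageI CollectI)
          then show "real4_of_rat ` {r. solves_eqn a b r} \<inter> A \<noteq> {}"
            using inN N(1) by blast
        qed
      qed
    qed
  next
    assume R: ?R
    show "real_points a b \<subseteq> wproj_topology closure_of rational_points a b"
    proof
      fix p assume p: "p \<in> real_points a b"
      then obtain v where v: "v \<noteq> 0" "solves_eqn a b v" "p = wpoint v"
        by (auto simp: real_points_def)
      show "p \<in> wproj_topology closure_of rational_points a b"
        unfolding in_closure_of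
      proof (intro conjI allI impI)
        show "p \<in> topspace wproj_topology"
          using p real_points_subset topspace_wproj_topology by blast
        fix U assume U: "p \<in> U \<and> openin wproj_topology U"
        then have op: "open {u. u \<noteq> 0 \<and> wpoint u \<in> U}"
          by (simp add: openin_wproj_topology)
        have "v \<in> closure (real4_of_rat ` {r. solves_eqn a b r})" using R v by auto
        then have "real4_of_rat ` {r. solves_eqn a b r} \<inter> {u. u \<noteq> 0 \<and> wpoint u \<in> U} \<noteq> {}"
          using op U v unfolding closure_iff_nhds_not_empty by blast
        then obtain r where "solves_eqn a b r" "real4_of_rat r \<noteq> 0"
          "wpoint (real4_of_rat r) \<in> U"
          by blast
        then show "\<exists>y. y \<in> rational_points a b \<and> y \<in> U"
          unfolding rational_points_def using real4_of_rat_eq_0_iff by blast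
      qed
    qed
  qed
  finally show ?thesis .
qed

end

theory Submission
  imports Defs
begin

text \<open>Put $c = b/a$. A point of the surface with
  $x - y^3 = c t^3 (z^3 - w^3)$ and $t^3 (x + y^3) = z^3 + w^3$ lies on the cubic curve
  $2 (t y)^3 = (1 - c t^6) z^3 + (1 + c t^6) w^3$, which contains $(t y, z, w) = (1, 1, 1)$.
  The tangent there meets the curve again in a point that is polynomial in $t$; this gives the
  polynomial solutions.

  For density, the real points of all these cubics are identified with those of one fixed cubic by
  taking cubes of the coordinates. The tangent map $P \mapsto -2P$ expands the invariant
  differential by 2, so the iterated preimages of any point are dense. The base point
  $(1, 1, 1)$ corresponds to the parameter $-2/(1 + c t^6)$, which moves with $t$. Hence,
  arbitrarily close to a given $t$, some iterate of the base point hits any prescribed real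
  point; by continuity a nearby rational $t$ gives a rational point close to it. The trivial
  solutions, which may lie on none of the cubics, form curves with obvious dense sets of rational
  points.\<close>

section \<open>Real analysis\<close>

lemma integrable_on_if_absolutely_integrable_on_UNIV:
  fixes f :: "'a::euclidean_space \<Rightarrow> 'b::euclidean_space"
  assumes "f absolutely_integrable_on UNIV" "S \<in> sets lebesgue"
  shows "f integrable_on S"
  using set_integrable_subset[OF assms] by (simp add: set_lebesgue_integral_eq_integral)

lemma integral_atMost_split:
  fixes f :: "real \<Rightarrow> 'a::euclidean_space"
  assumes f: "f absolutely_integrable_on UNIV" and "x \<le> y"
  shows "integral {..y} f = integral {..x} f + integral {x..y} f"
proof -
  have "{..x} \<inter> {x..y} = {x}" "{..x} \<union> {x..y} = {..y}"
    using \<open>x \<le> y\<close> by auto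
  then show ?thesis
    using integral_Un[of f "{..x}" "{x..y}"] integrable_on_if_absolutely_integrable_on_UNIV[OF f]
    by simp
qed

lemma isCont_integral_atMost:
  fixes f :: "real \<Rightarrow> 'a::euclidean_space"
  assumes f: "f absolutely_integrable_on UNIV"
  shows "isCont (\<lambda>x. integral {..x} f) x"
proof -
  have "f integrable_on {x - 1..x + 1}"
    using f by (rule integrable_on_if_absolutely_integrable_on_UNIV) simp
  then have "continuous_on {x - 1..x + 1} (\<lambda>u. integral {..x - 1} f + integral {x - 1..u} f)"
    by (intro continuous_intros indefinite_integral_continuous_1)
  then have "continuous_on {x - 1..x + 1} (\<lambda>u. integral {..u} f)"
    by (rule continuous_on_eq) (simp flip: integral_atMost_split[OF f])
  then show ?thesis
    by (rule continuous_on_interior) simp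
qed

lemma has_vector_derivative_integral_atMost:
  fixes f :: "real \<Rightarrow> 'a::euclidean_space"
  assumes f: "f absolutely_integrable_on UNIV" and "isCont f x"
  shows "((\<lambda>x. integral {..x} f) has_vector_derivative f x) (at x)"
proof -
  have "f integrable_on {x - 1..x + 1}"
    using f by (rule integrable_on_if_absolutely_integrable_on_UNIV) simp
  then have "((\<lambda>u. integral {x - 1..u} f) has_vector_derivative f x)
      (at x within ({x - 1..x + 1} - {}))"
    by (rule integral_has_vector_derivative_continuous_at)
      (use \<open>isCont f x\<close> in \<open>simp_all add: continuous_at_imp_continuous_at_within\<close>)
  then have "((\<lambda>u. integral {..x - 1} f + integral {x - 1..u} f) has_vector_derivative f x)
      (at x within {x - 1..x + 1})"
    by (simp add: add.commute[of "integral {..x - 1} f"] has_vector_derivative_add_const)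
  then have "((\<lambda>u. integral {..u} f) has_vector_derivative f x) (at x within {x - 1..x + 1})"
    by (rule has_vector_derivative_transform[rotated 2])
      (simp_all flip: integral_atMost_split[OF f])
  then show ?thesis
    by (simp add: at_within_interior[of x "{x - 1..x + 1}"])
qed

lemma mono_integral_atMost:
  fixes f :: "real \<Rightarrow> real"
  assumes f: "f absolutely_integrable_on UNIV" and "\<And>x. f x \<ge> 0"
  shows "mono (\<lambda>x. integral {..x} f)"
  using assms(2) integrable_on_if_absolutely_integrable_on_UNIV[OF f]
  by (intro monoI integral_subset_le) auto

lemma integral_atMost_bounds:
  fixes f :: "real \<Rightarrow> real"
  assumes f: "f absolutely_integrable_on UNIV" and "\<And>x. f x \<ge> 0"
  shows "integral {..x} f \<in> {0..integral UNIV f}"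
  using assms(2) integrable_on_if_absolutely_integrable_on_UNIV[OF f]
  by (simp add: integral_nonneg integral_subset_le)

lemma strict_mono_if_DERIV_pos_off_finite:
  fixes f :: "real \<Rightarrow> real"
  assumes "mono f" "finite S" and deriv: "\<And>x. x \<notin> S \<Longrightarrow> \<exists>d > 0. DERIV f x :> d"
  shows "strict_mono f"
proof (rule strict_monoI)
  fix x y :: real assume "x < y"
  have "open ({x<..<y} - S)"
    using \<open>finite S\<close> by (intro open_Diff finite_imp_closed) auto
  moreover have "{x<..<y} - S \<noteq> {}"
    using \<open>x < y\<close> \<open>finite S\<close> by (metis Diff_eq_empty_iff finite_subset infinite_Ioo)
  ultimately obtain c e where e: "e > 0" "cball c e \<subseteq> {x<..<y} - S"
    by (meson all_not_in_conv open_contains_cball)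
  then have sub: "{c - e..c + e} \<subseteq> {x<..<y} - S"
    by (simp add: cball_eq_atLeastAtMost)
  then have "c - e \<in> {x<..<y}" "c + e \<in> {x<..<y}"
    using subsetD[OF sub, of "c - e"] subsetD[OF sub, of "c + e"] \<open>e > 0\<close> by auto
  then have "f x \<le> f (c - e)" "f (c + e) \<le> f y"
    using \<open>mono f\<close> by (auto intro: monoD)
  moreover have "f (c - e) < f (c + e)"
  proof (rule DERIV_pos_imp_increasing[of "c - e" "c + e" f])
    fix u assume "c - e \<le> u" "u \<le> c + e"
    then have "u \<notin> S"
      using sub by auto
    then show "\<exists>d. DERIV f u :> d \<and> d > 0"
      using deriv by blast
  qed (use \<open>e > 0\<close> in simp)
  ultimately show "f x < f y"
    by linarith
qed

lemma isCont_closure_in_closed: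
  fixes f :: "'a::t2_space \<Rightarrow> 'b::topological_space"
  assumes "p \<in> closure A" "isCont f p" "closed C" "\<forall>\<^sub>F x in nhds p. x \<in> A \<longrightarrow> f x \<in> C"
  shows "f p \<in> C"
proof (rule ccontr)
  assume "f p \<notin> C"
  then have "\<forall>\<^sub>F x in nhds p. f x \<in> - C"
    using assms(2,3) by (intro topological_tendstoD[where l = "f p"])
      (auto simp: isCont_def tendsto_at_iff_tendsto_nhds)
  with assms(4) have "\<forall>\<^sub>F x in nhds p. x \<notin> A"
    by eventually_elim auto
  then obtain S where "open S" "p \<in> S" "S \<inter> A = {}"
    unfolding eventually_nhds by blast
  then show False
    using assms(1) open_Int_closure_eq_empty[of S A] by blast
qed

lemma eventually_at_poly_ne_0:
  fixes p :: "'a::{idom, t1_space} poly"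
  assumes "p \<noteq> 0"
  shows "\<forall>\<^sub>F x in at a. poly p x \<noteq> 0"
  using islimpt_finite[OF poly_roots_finite[OF assms]] unfolding islimpt_iff_eventually
  by (simp add: eventually_mono)

lemma DERIV_nonzero_imp_interior_image:
  fixes f :: "'a::{real_normed_field, euclidean_space} \<Rightarrow> 'a"
  assumes "open U" "x \<in> U" "continuous_on U f" "DERIV f x :> d" "d \<noteq> 0"
  shows "f x \<in> interior (f ` U)"
proof (rule sussmann_open_mapping)
  show "(f has_derivative (*) d) (at x)"
    using assms by (simp add: has_field_derivative_def)
  show "bounded_linear ((*) (inverse d))"
    by (rule bounded_linear_mult_right)
  show "(*) d \<circ> (*) (inverse d) = id"
    using assms by (auto simp: fun_eq_iff)
qed (use assms in \<open>auto simp: interior_open\<close>)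

section \<open>Polynomial solutions\<close>

lemma solves_eqn_if_on_fibre:
  fixes r x y z w :: "'a::idom"
  assumes "of_int a * (x - y ^ 3) = of_int b * r * (z ^ 3 - w ^ 3)"
    and "r * (x + y ^ 3) = z ^ 3 + w ^ 3"
  shows "solves_eqn a b (x, y, z, w)"
proof -
  have "of_int a * (x\<^sup>2 - y ^ 6) = of_int a * (x - y ^ 3) * (x + y ^ 3)"
    by algebra
  also have "\<dots> = of_int b * (z ^ 3 - w ^ 3) * (r * (x + y ^ 3))"
    unfolding assms(1) by algebra
  also have "\<dots> = of_int b * (z ^ 6 - w ^ 6)"
    unfolding assms(2) by algebra
  finally show ?thesis
    by (simp add: solves_eqn_def)
qed

text \<open>With $3 u = c t^6$, the tangent at $(1, 1, 1)$ meets the cubic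
  $2 (t y)^3 = (1 - c t^6) z^3 + (1 + c t^6) w^3$ again in $(t y, z, w) = (-2 u, u + 1, u - 1)$.
  Taking $t = 6 a s$ makes all coordinates integral and $u$ even, so that $u + 1$ and $u - 1$ are
  coprime.\<close>

definition tangent_solution :: "int \<Rightarrow> int \<Rightarrow> 'a::comm_ring_1 \<Rightarrow> 'a \<times> 'a \<times> 'a \<times> 'a" where
  "tangent_solution a b s =
    (let u = 15552 * of_int b * of_int a ^ 5 * s ^ 6;
         y = - 5184 * of_int b * of_int a ^ 4 * s ^ 5;
         x = y ^ 3 + 216 * of_int b * (of_int a)\<^sup>2 * s ^ 3 * ((u + 1) ^ 3 - (u - 1) ^ 3)
     in (x, y, u + 1, u - 1))"

lemma solves_eqn_tangent_solution:
  fixes s :: "'a::idom"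
  shows "solves_eqn a b (tangent_solution a b s)"
proof -
  define A B :: 'a where "A = of_int a" and "B = of_int b"
  define u where "u = 15552 * B * A ^ 5 * s ^ 6"
  define y where "y = - 5184 * B * A ^ 4 * s ^ 5"
  define D where "D = (u + 1) ^ 3 - (u - 1) ^ 3"
  define x where "x = y ^ 3 + 216 * B * A\<^sup>2 * s ^ 3 * D"
  have "solves_eqn a b (x, y, u + 1, u - 1)"
  proof (rule solves_eqn_if_on_fibre, fold A_def B_def)
    show "A * (x - y ^ 3) = B * (6 * A * s) ^ 3 * ((u + 1) ^ 3 - (u - 1) ^ 3)"
      unfolding x_def D_def by algebra
    have "(6 * A * s) ^ 3 * (x + y ^ 3) = 2 * (6 * A * s * y) ^ 3 + 3 * u * D"
      unfolding x_def u_def by algebra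
    also have "6 * A * s * y = - 2 * u"
      unfolding y_def u_def by algebra
    also have "2 * (- 2 * u) ^ 3 + 3 * u * D = (u + 1) ^ 3 + (u - 1) ^ 3"
      unfolding D_def by algebra
    finally show "(6 * A * s) ^ 3 * (x + y ^ 3) = (u + 1) ^ 3 + (u - 1) ^ 3" .
  qed
  then show ?thesis
    by (simp add: tangent_solution_def Let_def A_def B_def u_def y_def x_def D_def)
qed

lemma power_eq_iff_abs_eq:
  fixes x y :: "'a::linordered_idom"
  assumes "even n" "n > 0"
  shows "x ^ n = y ^ n \<longleftrightarrow> \<bar>x\<bar> = \<bar>y\<bar>"
  using assms by (metis abs_ge_zero power_eq_iff_eq_base power_even_abs)

lemma tangent_solution_not_trivial:
  fixes s :: "'a::linordered_idom"
  assumes "a \<noteq> 0" "b \<noteq> 0" "s \<noteq> 0"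
  shows "\<not> trivial_sol a b (tangent_solution a b s)"
proof
  define u where "u = 15552 * of_int b * of_int a ^ 5 * s ^ 6"
  have "u \<noteq> 0"
    using assms by (simp add: u_def)
  assume "trivial_sol a b (tangent_solution a b s)"
  then have "(u + 1) ^ 6 = (u - 1) ^ 6"
    using assms by (simp add: trivial_sol_def tangent_solution_def Let_def u_def)
  then have "\<bar>u + 1\<bar> = \<bar>u - 1\<bar>"
    by (simp only: power_eq_iff_abs_eq even_numeral zero_less_numeral)
  with \<open>u \<noteq> 0\<close> show False
    by (auto simp: abs_eq_iff)
qed

lemma coprime_add_one_diff_one_if_even:
  fixes u :: "'a::ring_gcd"
  assumes "2 dvd u"
  shows "coprime (u + 1) (u - 1)"
proof (rule coprimeI)
  fix d assume d: "d dvd u + 1" "d dvd u - 1"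
  then have "d dvd (u + 1) - (u - 1)"
    by (rule dvd_diff)
  then have "d dvd u"
    using assms by (auto elim: dvd_trans)
  then show "is_unit d"
    using d(1) by (simp add: dvd_add_right_iff)
qed

lemma gcd_tangent_solution:
  fixes s :: "'a::ring_gcd"
  assumes "tangent_solution a b s = (x, y, z, w)"
  shows "gcd x (gcd y (gcd z w)) = 1"
proof -
  define u where "u = 15552 * of_int b * of_int a ^ 5 * s ^ 6"
  have "u = 2 * (7776 * of_int b * of_int a ^ 5 * s ^ 6)"
    by (simp add: u_def)
  then have "coprime (u + 1) (u - 1)"
    by (intro coprime_add_one_diff_one_if_even) (rule dvdI)
  moreover have "z = u + 1" "w = u - 1"
    using assms by (simp_all add: tangent_solution_def Let_def u_def)
  ultimately show ?thesis
    by simp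
qed

lemma inj_tangent_solution_monom:
  assumes "a \<noteq> 0" "b \<noteq> 0"
  shows "inj (\<lambda>n. tangent_solution a b (monom 1 (Suc n) :: int poly))"
proof (rule injI)
  fix m n
  assume "tangent_solution a b (monom 1 (Suc m) :: int poly)
    = tangent_solution a b (monom 1 (Suc n))"
  then have "(monom 1 (Suc m) :: int poly) ^ 6 = monom 1 (Suc n) ^ 6"
    using assms by (simp add: tangent_solution_def Let_def)
  then show "m = n"
    by (simp add: monom_power monom_eq_iff')
qed

lemma infinite_coprime_polynomial_solutions:
  fixes a b :: int
  assumes "a \<noteq> 0" and "b \<noteq> 0"
  shows "infinite {(x :: int poly, y :: int poly, z :: int poly, w :: int poly).
           solves_eqn a b (x, y, z, w) \<and> \<not> trivial_sol a b (x, y, z, w) \<and>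
           gcd x (gcd y (gcd z w)) = 1}" (is "infinite ?S")
proof -
  have "tangent_solution a b s \<in> ?S" if "s \<noteq> 0" for s :: "int poly"
    using solves_eqn_tangent_solution[of a b s] tangent_solution_not_trivial[OF assms that]
      gcd_tangent_solution[of a b s]
    by (cases "tangent_solution a b s") simp
  then have "range (\<lambda>n. tangent_solution a b (monom 1 (Suc n))) \<subseteq> ?S"
    by (intro image_subsetI) (simp only: monom_eq_0_iff one_neq_zero not_False_eq_True)
  then show ?thesis
    using inj_tangent_solution_monom[OF assms] range_inj_infinite infinite_super by blast
qed

section \<open>The tangent map\<close>

text \<open>Drawing tangents maps the curve $A X^3 + B Y^3 + C Z^3 = 0$ to itself by
  $(X, Y, Z) \mapsto (X (B Y^3 - C Z^3), Y (C Z^3 - A X^3), Z (A X^3 - B Y^3))$. In the real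
  coordinate $m = A X^3 / (C Z^3)$, which no longer depends on the coefficients, this becomes the
  following map. Exchanging $X$ and $Y$ turns $m$ into $- 1 - m$.\<close>

definition tangent_map :: "real \<Rightarrow> real" where
  "tangent_map m = - m * ((m + 2) / (2 * m + 1)) ^ 3"

definition tangent_factor :: "real \<Rightarrow> real" where
  "tangent_factor m = (m + 2) * (1 - m) / (2 * m + 1)\<^sup>2"

lemma one_plus_tangent_map:
  assumes "m \<noteq> -1/2"
  shows "1 + tangent_map m = (1 + m) * ((1 - m) / (2 * m + 1)) ^ 3"
proof -
  have "(2 * m + 1) ^ 3 \<noteq> 0"
    using assms by auto
  then have "1 + tangent_map m = ((2 * m + 1) ^ 3 - m * (m + 2) ^ 3) / (2 * m + 1) ^ 3"
    by (simp add: tangent_map_def power_divide diff_divide_distrib)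
  also have "(2 * m + 1) ^ 3 - m * (m + 2) ^ 3 = (1 + m) * (1 - m) ^ 3"
    by algebra
  finally show ?thesis
    by (simp add: power_divide)
qed

lemma tangent_map_reflect:
  assumes "m \<noteq> -1/2"
  shows "tangent_map (- 1 - m) = - 1 - tangent_map m"
proof -
  have "(- 1 - m + 2) / (2 * (- 1 - m) + 1) = (1 - m) / - (2 * m + 1)"
    by (rule arg_cong2[where f = "(/)"]) auto
  then have "tangent_map (- 1 - m) = (1 + m) * (- ((1 - m) / (2 * m + 1))) ^ 3"
    by (simp only: tangent_map_def minus_divide_right) simp
  also have "\<dots> = - (1 + tangent_map m)"
    by (simp add: one_plus_tangent_map[OF assms] power_minus_odd)
  finally show ?thesis
    by simp
qed

lemma tangent_map_mult_one_plus:
  assumes "m \<noteq> -1/2"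
  shows "tangent_map m * (1 + tangent_map m) = - (m * (1 + m)) * tangent_factor m ^ 3"
  unfolding one_plus_tangent_map[OF assms] unfolding tangent_map_def tangent_factor_def
  by (simp add: power_divide power_mult_distrib flip: power_mult power_add)

lemma has_real_derivative_tangent_map:
  assumes "m \<noteq> -1/2"
  shows "(tangent_map has_real_derivative - 2 * (tangent_factor m)\<^sup>2) (at m)"
proof -
  define d where "d = 2 * m + 1"
  have d: "d \<noteq> 0"
    using assms by (auto simp: d_def)
  have "((\<lambda>m. (m + 2) / (2 * m + 1)) has_real_derivative ((2 * m + 1) - (m + 2) * 2) / d\<^sup>2) (at m)"
    using d unfolding d_def by (auto intro!: derivative_eq_intros simp: power2_eq_square)
  also have "(2 * m + 1) - (m + 2) * 2 = - 3"
    by simp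
  finally have quotient: "((\<lambda>m. (m + 2) / (2 * m + 1)) has_real_derivative - 3 / d\<^sup>2) (at m)" .
  have "((\<lambda>m. - m * ((m + 2) / (2 * m + 1)) ^ 3) has_real_derivative
      - (((m + 2) / d) ^ 3) - m * (3 * ((m + 2) / d)\<^sup>2 * (- 3 / d\<^sup>2))) (at m)"
    by (rule derivative_eq_intros quotient refl)+ (simp add: d_def)
  also have "- (((m + 2) / d) ^ 3) - m * (3 * ((m + 2) / d)\<^sup>2 * (- 3 / d\<^sup>2))
      = ((m + 2) / d)\<^sup>2 * ((9 * m - (m + 2) * d) / d\<^sup>2)"
    using d by (simp add: field_simps power2_eq_square power3_eq_cube)
  also have "9 * m - (m + 2) * d = - 2 * (1 - m)\<^sup>2"
    unfolding d_def by algebra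
  also have "((m + 2) / d)\<^sup>2 * (- 2 * (1 - m)\<^sup>2 / d\<^sup>2) = - 2 * (tangent_factor m)\<^sup>2"
    by (simp add: tangent_factor_def d_def power_divide power_mult_distrib)
  finally show ?thesis
    unfolding tangent_map_def[abs_def] .
qed

lemma isCont_tangent_map: "m \<noteq> -1/2 \<Longrightarrow> isCont tangent_map m"
  using has_real_derivative_tangent_map DERIV_isCont by blast

lemma tangent_map_eq_iff:
  assumes "m \<noteq> -1/2"
  shows "tangent_map m = k \<longleftrightarrow> m * (m + 2) ^ 3 + k * (2 * m + 1) ^ 3 = 0"
proof -
  have "2 * m + 1 \<noteq> 0"
    using assms by auto
  then show ?thesis
    by (auto simp: tangent_map_def power_divide divide_simps)
qed

lemma tangent_map_surj_right: "\<exists>m > -1/2. tangent_map m = k"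
proof -
  define p where "p = [:k, 8 + 6 * k, 12 + 12 * k, 6 + 8 * k, 1:]"
  have p: "poly p m = m * (m + 2) ^ 3 + k * (2 * m + 1) ^ 3" for m
    unfolding p_def by (simp add: algebra_simps power3_eq_cube)
  have "lead_coeff p > 0"
    by (simp add: p_def)
  then obtain n where "\<forall>m\<ge>n. lead_coeff p \<le> poly p m"
    using poly_pinfty_gt_lc by blast
  with \<open>lead_coeff p > 0\<close> have "poly p (max n 0) > 0"
    by (meson max.cobounded1 order_less_le_trans)
  moreover have "poly p (-1/2) < 0"
    by (simp add: p power3_eq_cube)
  ultimately obtain m where "m > -1/2" "poly p m = 0"
    using poly_IVT_pos[of "-1/2" "max n 0" p] by force
  then show ?thesis
    using tangent_map_eq_iff[of m k] by (auto simp: p)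
qed

lemma tangent_map_surj_left: "\<exists>m < -1/2. tangent_map m = k"
proof -
  obtain m where "m > -1/2" "tangent_map m = - 1 - k"
    using tangent_map_surj_right by blast
  then have "- 1 - m < -1/2" "tangent_map (- 1 - m) = k"
    by (auto simp: tangent_map_reflect)
  then show ?thesis
    by blast
qed

text \<open>At its pole $-1/2$ the tangent map has the junk value 0, so orbits through the pole are
  excluded.\<close>

definition tangent_step :: "real \<Rightarrow> real \<Rightarrow> bool" where
  "tangent_step m k \<longleftrightarrow> m \<noteq> -1/2 \<and> tangent_map m = k"

lemma eventually_tangent_orbit_meets:
  assumes "tangent_step\<^sup>*\<^sup>* m q" "open V" "q \<in> V"
  shows "\<forall>\<^sub>F k in nhds m. \<exists>p\<in>V. tangent_step\<^sup>*\<^sup>* k p"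
  using assms(1)
proof (induction rule: converse_rtranclp_induct)
  case base
  have "\<forall>\<^sub>F k in nhds q. k \<in> V"
    using assms(2,3) by (rule eventually_nhds_in_open)
  then show ?case
    by eventually_elim blast
next
  case (step m n)
  then have m: "m \<noteq> -1/2" "tangent_map m = n"
    by (simp_all add: tangent_step_def)
  then have "filterlim tangent_map (nhds n) (nhds m)"
    using isCont_tangent_map tendsto_at_iff_tendsto_nhds unfolding isCont_def by blast
  with step.IH have "\<forall>\<^sub>F k in nhds m. \<exists>p\<in>V. tangent_step\<^sup>*\<^sup>* (tangent_map k) p"
    by (rule eventually_compose_filterlim)
  moreover have "\<forall>\<^sub>F k in nhds m. k \<noteq> -1/2"
    using m(1) by (rule t1_space_nhds)
  ultimately show ?case
    by eventually_elim (meson converse_rtranclp_into_rtranclp tangent_step_def)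
qed

section \<open>Density of the preimages under the tangent map\<close>

definition invariant_density :: "real \<Rightarrow> real" where
  "invariant_density m = \<bar>m * (1 + m)\<bar> powr (-2/3)"

lemma invariant_density_nonneg: "invariant_density m \<ge> 0"
  by (simp add: invariant_density_def)

lemma invariant_density_reflect: "invariant_density (- 1 - m) = invariant_density m"
proof -
  have "(- 1 - m) * (1 + (- 1 - m)) = m * (1 + m)"
    by algebra
  then show ?thesis
    by (simp only: invariant_density_def)
qed

lemma isCont_invariant_density: "m \<noteq> 0 \<Longrightarrow> m \<noteq> -1 \<Longrightarrow> isCont invariant_density m"
  unfolding invariant_density_def[abs_def] by (intro continuous_intros) auto

text \<open>The tangent map is multiplication by $-2$ on an elliptic curve, and the density is that of
  the invariant differential.\<close>

lemma invariant_density_tangent_map: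
  assumes "m \<notin> {-1/2, -2, 1}"
  shows "invariant_density (tangent_map m) * (tangent_factor m)\<^sup>2 = invariant_density m"
proof -
  define r where "r = \<bar>tangent_factor m\<bar>"
  have "2 * m + 1 \<noteq> 0" "m + 2 \<noteq> 0" "1 - m \<noteq> 0"
    using assms by auto
  then have "r > 0"
    by (simp add: r_def tangent_factor_def)
  have "\<bar>tangent_map m * (1 + tangent_map m)\<bar> = \<bar>m * (1 + m)\<bar> * r powr 3"
    using assms \<open>r > 0\<close> by (simp add: tangent_map_mult_one_plus abs_mult power_abs r_def)
  then have "invariant_density (tangent_map m) = invariant_density m * r powr (-2)"
    by (simp add: invariant_density_def powr_mult powr_powr)
  also have "r powr (-2) = inverse (r\<^sup>2)"
    using \<open>r > 0\<close> by (simp add: powr_minus)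
  finally show ?thesis
    using \<open>r > 0\<close> by (simp add: r_def)
qed

lemma invariant_density_eq_powr_mult:
  "invariant_density m = \<bar>m\<bar> powr (-2/3) * \<bar>1 + m\<bar> powr (-2/3)"
  by (simp add: invariant_density_def abs_mult powr_mult)

lemma invariant_density_le_on_nonneg:
  assumes "m \<ge> 0"
  shows "invariant_density m \<le> m powr (-2/3)" and "invariant_density m \<le> m powr (-4/3)"
proof -
  have "invariant_density m \<le> m powr (-2/3) * 1"
    unfolding invariant_density_eq_powr_mult using assms powr_mono2'[of "-2/3" 1 "1 + m"]
    by (intro mult_mono) auto
  then show "invariant_density m \<le> m powr (-2/3)"
    by simp
  show "invariant_density m \<le> m powr (-4/3)"
  proof (cases "m = 0")
    case True
    then show ?thesis
      by (simp add: invariant_density_def)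
  next
    case False
    then have "invariant_density m \<le> m powr (-2/3) * m powr (-2/3)"
      unfolding invariant_density_eq_powr_mult using assms
      by (intro mult_mono powr_mono2') auto
    then show ?thesis
      by (simp flip: powr_add)
  qed
qed

lemma invariant_density_measurable: "invariant_density \<in> borel_measurable borel"
  unfolding invariant_density_def[abs_def] by measurable

lemma invariant_density_absolutely_integrable_on_unit:
  "invariant_density absolutely_integrable_on {-1..0}"
proof -
  have "integrable lborel (\<lambda>t::real. indicator {0..1} t *\<^sub>R (t powr (-2/3) * (1 - t) powr (-2/3)))"
    using integrable_Beta[of "1/3" "1/3"] by (simp add: set_integrable_def)
  from lborel_integrable_real_affine[OF this, of "-1" 0]
  have "integrable lborel
      (\<lambda>m::real. indicator {0..1} (- m) *\<^sub>R ((- m) powr (-2/3) * (1 + m) powr (-2/3)))"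
    by simp
  also have "(\<lambda>m::real. indicator {0..1} (- m) *\<^sub>R ((- m) powr (-2/3) * (1 + m) powr (-2/3)))
      = (\<lambda>m::real. indicator {-1..0} m *\<^sub>R invariant_density m)"
    by (auto simp: fun_eq_iff indicator_def invariant_density_eq_powr_mult)
  finally show ?thesis
    unfolding set_integrable_def by (rule integrable_completion[THEN iffD2, rotated])
      (use invariant_density_measurable in measurable)
qed

lemma invariant_density_absolutely_integrable_on_nonneg:
  "invariant_density absolutely_integrable_on {0..}"
proof -
  have integrable: "invariant_density absolutely_integrable_on S"
    if "(\<lambda>m. m powr e) integrable_on S" "S \<in> sets borel"
      "\<And>m. m \<in> S \<Longrightarrow> invariant_density m \<le> m powr e"
    for S e
  proof (rule measurable_bounded_by_integrable_imp_absolutely_integrable[OF _ _ that(1)])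
    show "invariant_density \<in> borel_measurable (lebesgue_on S)"
      by (intro measurable_restrict_space1 measurable_completion)
        (simp add: invariant_density_measurable)
  qed (use that invariant_density_nonneg in auto)
  have "invariant_density absolutely_integrable_on {0..1}"
    by (rule integrable[of "-2/3", OF integrable_on_powr_from_0])
      (use invariant_density_le_on_nonneg(1) in auto)
  moreover have "(\<lambda>m::real. m powr (-4/3)) integrable_on {1..}"
    using has_integral_powr_to_inf[of "-4/3" 1] by (auto simp: integrable_on_def)
  then have "invariant_density absolutely_integrable_on {1..}"
    by (rule integrable) (use invariant_density_le_on_nonneg(2) in auto)
  ultimately have "invariant_density absolutely_integrable_on ({0..1} \<union> {1..})"
    by (rule absolutely_integrable_Un)
  moreover have "{0..1} \<union> {1..} = {0::real..}"
    by auto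
  ultimately show ?thesis
    by simp
qed

lemma invariant_density_absolutely_integrable: "invariant_density absolutely_integrable_on UNIV"
proof -
  have "integrable lebesgue
      (\<lambda>m. indicator {0..} (- 1 + (- 1) * m) *\<^sub>R invariant_density (- 1 + (- 1) * m))"
    using invariant_density_absolutely_integrable_on_nonneg
    unfolding set_integrable_def by (rule lebesgue_integrable_real_affine) simp
  also have "(\<lambda>m. indicator {0..} (- 1 + (- 1) * m) *\<^sub>R invariant_density (- 1 + (- 1) * m))
      = (\<lambda>m. indicator {..-1} m *\<^sub>R invariant_density m)"
    using invariant_density_reflect by (auto simp: fun_eq_iff indicator_def)
  finally have "invariant_density absolutely_integrable_on {..-1}"
    unfolding set_integrable_def .
  then have "invariant_density absolutely_integrable_on ({..-1} \<union> {-1..0} \<union> {0..})"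
    by (intro absolutely_integrable_Un invariant_density_absolutely_integrable_on_unit
        invariant_density_absolutely_integrable_on_nonneg)
  moreover have "{..-1} \<union> {-1..0} \<union> {0..} = (UNIV :: real set)"
    by auto
  ultimately show ?thesis
    by simp
qed

definition arc_length :: "real \<Rightarrow> real" where
  "arc_length m = integral {..m} invariant_density"

abbreviation total_arc_length :: real where
  "total_arc_length \<equiv> integral UNIV invariant_density"

lemma abs_arc_length_diff_le: "\<bar>arc_length m - arc_length k\<bar> \<le> total_arc_length"
  using integral_atMost_bounds[OF invariant_density_absolutely_integrable invariant_density_nonneg]
  unfolding arc_length_def by (smt (verit) atLeastAtMost_iff)

lemma isCont_arc_length: "isCont arc_length m"
  unfolding arc_length_def[abs_def]
  by (rule isCont_integral_atMost[OF invariant_density_absolutely_integrable])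

lemma has_real_derivative_arc_length:
  assumes "m \<noteq> 0" "m \<noteq> -1"
  shows "(arc_length has_real_derivative invariant_density m) (at m)"
  unfolding arc_length_def[abs_def] has_real_derivative_iff_has_vector_derivative
  using invariant_density_absolutely_integrable isCont_invariant_density[OF assms]
  by (rule has_vector_derivative_integral_atMost)

lemma strict_mono_arc_length: "strict_mono arc_length"
proof (rule strict_mono_if_DERIV_pos_off_finite)
  show "mono arc_length"
    unfolding arc_length_def[abs_def]
    using invariant_density_absolutely_integrable invariant_density_nonneg
    by (rule mono_integral_atMost)
  show "finite {0, -1 :: real}"
    by simp
  fix m :: real assume "m \<notin> {0, -1}"
  then show "\<exists>d > 0. DERIV arc_length m :> d"
    using has_real_derivative_arc_length[of m]
    by (intro exI[of _ "invariant_density m"]) (auto simp: invariant_density_def)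
qed

lemma has_real_derivative_arc_length_tangent_map:
  assumes "m \<notin> {0, -1, -1/2, -2, 1}"
  shows "((\<lambda>m. arc_length (tangent_map m)) has_real_derivative - 2 * invariant_density m) (at m)"
proof -
  have m: "m \<noteq> -1/2" "m \<notin> {-1/2, -2, 1}"
    using assms by auto
  have "2 * m + 1 \<noteq> 0"
    using m by auto
  then have "tangent_map m \<noteq> 0" "1 + tangent_map m \<noteq> 0"
    using assms unfolding one_plus_tangent_map[OF m(1)] by (auto simp: tangent_map_def)
  then have "((\<lambda>m. arc_length (tangent_map m)) has_real_derivative
      invariant_density (tangent_map m) * (- 2 * (tangent_factor m)\<^sup>2)) (at m)"
    using has_real_derivative_tangent_map[OF m(1)]
    by (intro DERIV_chain2[OF has_real_derivative_arc_length]) auto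
  also have "invariant_density (tangent_map m) * (- 2 * (tangent_factor m)\<^sup>2)
      = - 2 * invariant_density m"
    using invariant_density_tangent_map[OF m(2)] by simp
  finally show ?thesis .
qed

lemma arc_length_tangent_map_diff:
  assumes I: "connected I" "open I" "-1/2 \<notin> I" and "m \<in> I" "k \<in> I"
  shows "arc_length (tangent_map m) - arc_length (tangent_map k)
    = - 2 * (arc_length m - arc_length k)"
proof -
  define h where "h m = arc_length (tangent_map m) + 2 * arc_length m" for m
  have "continuous_on I h"
    unfolding h_def using I(3)
    by (intro continuous_at_imp_continuous_on ballI continuous_intros isCont_arc_length
        isCont_o2[OF isCont_tangent_map]) auto
  moreover have "DERIV h m :> 0" if "m \<in> I - {0, -1, -2, 1}" for m
  proof -
    have "DERIV h m :> - 2 * invariant_density m + 2 * invariant_density m"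
      unfolding h_def using that I(3)
      by (intro DERIV_add DERIV_cmult has_real_derivative_arc_length
          has_real_derivative_arc_length_tangent_map) auto
    then show ?thesis
      by simp
  qed
  ultimately obtain c where "\<And>m. m \<in> I \<Longrightarrow> h m = c"
    using DERIV_zero_connected_constant[OF I(1,2), of "{0, -1, -2, 1}" h] by blast
  then have "h m = h k"
    using \<open>m \<in> I\<close> \<open>k \<in> I\<close> by simp
  then show ?thesis
    by (simp add: h_def)
qed

lemma tangent_map_preimage_halves_distance:
  assumes "m \<noteq> -1/2"
  obtains k where "tangent_step k p"
    "2 * \<bar>arc_length k - arc_length m\<bar> = \<bar>arc_length p - arc_length (tangent_map m)\<bar>"
proof -
  obtain I where I: "I \<in> {{..<-1/2}, {-1/2<..}}" "m \<in> I"
    using assms by (metis greaterThan_iff insertCI lessThan_iff linorder_neqE)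
  then obtain k where "k \<in> I" "tangent_map k = p"
    using tangent_map_surj_left[of p] tangent_map_surj_right[of p] by auto
  moreover from this have "k \<noteq> -1/2"
    using I by auto
  moreover have "connected I" "open I" "-1/2 \<notin> I"
    using I(1) by auto
  note arc_length_tangent_map_diff[OF this \<open>k \<in> I\<close> \<open>m \<in> I\<close>]
  then have "\<bar>arc_length (tangent_map k) - arc_length (tangent_map m)\<bar>
      = 2 * \<bar>arc_length k - arc_length m\<bar>"
    by (simp only: abs_mult abs_neg_numeral)
  ultimately show ?thesis
    using that[of k] by (simp add: tangent_step_def)
qed

lemma tangent_orbit_preimage_close:
  assumes "e > 0"
  shows "\<exists>k. tangent_step\<^sup>*\<^sup>* k q \<and>
           \<bar>arc_length k - arc_length m\<bar> < total_arc_length / 2 ^ n + e"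
  using assms
proof (induction n arbitrary: m e)
  case 0
  then show ?case
    using abs_arc_length_diff_le[of q m] by (intro exI[of _ q]) auto
next
  case (Suc n)
  have "\<forall>\<^sub>F m' in at m. \<bar>arc_length m' - arc_length m\<bar> < e / 2 \<and> m' \<noteq> -1/2"
    using tendstoD[OF isContD[OF isCont_arc_length], of "e / 2" m] \<open>e > 0\<close>
    by (intro eventually_conj eventually_neq_at_within) (simp add: dist_real_def)
  from eventually_happens'[OF at_neq_bot this]
  obtain m' where m': "\<bar>arc_length m' - arc_length m\<bar> < e / 2" "m' \<noteq> -1/2"
    by blast
  obtain p where p: "tangent_step\<^sup>*\<^sup>* p q"
    "\<bar>arc_length p - arc_length (tangent_map m')\<bar> < total_arc_length / 2 ^ n + e"
    using Suc by blast
  obtain k where k: "tangent_step k p"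
    "2 * \<bar>arc_length k - arc_length m'\<bar> = \<bar>arc_length p - arc_length (tangent_map m')\<bar>"
    using m'(2) by (rule tangent_map_preimage_halves_distance)
  have "\<bar>arc_length k - arc_length m'\<bar> < total_arc_length / 2 ^ Suc n + e / 2"
    using p(2) unfolding k(2)[symmetric] by (simp add: field_simps)
  then have "\<bar>arc_length k - arc_length m\<bar> < total_arc_length / 2 ^ Suc n + e"
    using m'(1) by linarith
  then show ?case
    using converse_rtranclp_into_rtranclp[of tangent_step, OF k(1) p(1)] by blast
qed

lemma tangent_orbit_preimages_dense: "closure {k. tangent_step\<^sup>*\<^sup>* k q} = UNIV"
proof -
  have "\<exists>k. tangent_step\<^sup>*\<^sup>* k q \<and> \<bar>k - m\<bar> < d" if "d > 0" for m d
  proof -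
    define e where "e = min (arc_length m - arc_length (m - d)) (arc_length (m + d) - arc_length m)"
    have "e > 0"
      using \<open>d > 0\<close> strict_mono_arc_length by (simp add: e_def strict_mono_less)
    have "(\<lambda>n. total_arc_length / 2 ^ n) \<longlonglongrightarrow> 0"
      by (rule LIMSEQ_divide_realpow_zero) simp
    then have "\<forall>\<^sub>F n in sequentially. total_arc_length / 2 ^ n < e / 2"
      using \<open>e > 0\<close> by (intro order_tendstoD(2)) auto
    then obtain n where n: "total_arc_length / 2 ^ n < e / 2"
      by (auto simp: eventually_sequentially)
    obtain k where k: "tangent_step\<^sup>*\<^sup>* k q"
      "\<bar>arc_length k - arc_length m\<bar> < total_arc_length / 2 ^ n + e / 2"
      using tangent_orbit_preimage_close[of "e / 2"] \<open>e > 0\<close> by (metis half_gt_zero)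
    then have "\<bar>arc_length k - arc_length m\<bar> < e"
      using n by linarith
    then have "arc_length (m - d) < arc_length k" "arc_length k < arc_length (m + d)"
      unfolding e_def by linarith+
    then have "\<bar>k - m\<bar> < d"
      using strict_mono_less[OF strict_mono_arc_length] by auto
    then show ?thesis
      using k(1) by blast
  qed
  then show ?thesis
    by (auto simp: closure_approachable dist_real_def)
qed

section \<open>Rational points on the cubics\<close>

text \<open>Here and below $N$ stands for $c t^6$; $(X, Y, 1)$ is a point of the cubic with
  $t y = X w$ and $z = Y w$, and $m$ is its coordinate as above.\<close>

definition rational_coordinate :: "real \<Rightarrow> real \<Rightarrow> bool" where
  "rational_coordinate N m \<longleftrightarrow>
    (\<exists>X\<in>\<rat>. \<exists>Y\<in>\<rat>. 2 * X ^ 3 = (1 - N) * Y ^ 3 + (1 + N) \<and> (1 + N) * m = - 2 * X ^ 3)"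

definition base_point :: "real \<Rightarrow> real" where
  "base_point N = - 2 / (1 + N)"

lemma rational_coordinate_base_point:
  assumes "1 + N \<noteq> 0"
  shows "rational_coordinate N (base_point N)"
proof -
  have "(1 + N) * base_point N = - 2"
    using nonzero_mult_div_cancel_left[OF assms, of "- 2"]
    by (simp only: base_point_def times_divide_eq_right)
  then show ?thesis
    unfolding rational_coordinate_def by (intro bexI[of _ 1]) simp_all
qed

lemma rational_coordinate_tangent_step:
  assumes "tangent_step m k" "rational_coordinate N m" "N \<in> \<rat>" "1 + N \<noteq> 0"
  shows "rational_coordinate N k"
proof -
  obtain X Y where X: "X \<in> \<rat>" "(1 + N) * m = - 2 * X ^ 3" and "Y \<in> \<rat>"
    and cubic: "2 * X ^ 3 = (1 - N) * Y ^ 3 + (1 + N)"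
    using assms(2) unfolding rational_coordinate_def by blast
  have k: "tangent_map m = k" "m \<noteq> -1/2"
    using assms(1) by (simp_all add: tangent_step_def)
  have "m = - 2 * X ^ 3 / (1 + N)"
    using X(2) \<open>1 + N \<noteq> 0\<close> by (simp add: field_simps)
  then have "m \<in> \<rat>"
    using X(1) \<open>N \<in> \<rat>\<close> by simp
  define X' where "X' = - X * ((m + 2) / (2 * m + 1))"
  define Y' where "Y' = Y * ((1 - m) / (2 * m + 1))"
  have "(1 + N) * k = - ((1 + N) * m) * ((m + 2) / (2 * m + 1)) ^ 3"
    unfolding k(1)[symmetric] tangent_map_def by simp
  also have "\<dots> = - 2 * X' ^ 3"
    unfolding X(2) X'_def by algebra
  finally have "(1 + N) * k = - 2 * X' ^ 3" .
  have "(1 + N) * (1 + k) = ((1 + N) + (1 + N) * m) * ((1 - m) / (2 * m + 1)) ^ 3"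
    unfolding k(1)[symmetric] one_plus_tangent_map[OF k(2)] by algebra
  also have "\<dots> = - (1 - N) * Y' ^ 3"
    unfolding X(2) mult_minus_left cubic Y'_def by algebra
  finally have "(1 + N) * (1 + k) = - (1 - N) * Y' ^ 3" .
  then have "2 * X' ^ 3 = (1 - N) * Y' ^ 3 + (1 + N)"
    using \<open>(1 + N) * k = - 2 * X' ^ 3\<close> by algebra
  moreover have "X' \<in> \<rat>" "Y' \<in> \<rat>"
    using X(1) \<open>Y \<in> \<rat>\<close> \<open>m \<in> \<rat>\<close> by (simp_all add: X'_def Y'_def)
  ultimately show ?thesis
    using \<open>(1 + N) * k = - 2 * X' ^ 3\<close> unfolding rational_coordinate_def by blast
qed

lemma rational_coordinate_tangent_orbit:
  assumes "tangent_step\<^sup>*\<^sup>* (base_point N) m" "N \<in> \<rat>" "1 + N \<noteq> 0"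
  shows "rational_coordinate N m"
  using assms(1)
  by (induction rule: rtranclp_induct)
    (use assms(2,3) in
      \<open>auto intro: rational_coordinate_base_point rational_coordinate_tangent_step\<close>)

lemma isCont_base_point: "1 + c * t ^ 6 \<noteq> 0 \<Longrightarrow> isCont (\<lambda>t. base_point (c * t ^ 6)) t"
  unfolding base_point_def by (intro continuous_intros)

lemma base_point_orbit_hits:
  fixes c t q :: real
  assumes "c \<noteq> 0" "t \<noteq> 0" "1 + c * t ^ 6 \<noteq> 0" "open U" "t \<in> U"
  obtains s where "s \<in> U" "1 + c * s ^ 6 \<noteq> 0" "tangent_step\<^sup>*\<^sup>* (base_point (c * s ^ 6)) q"
proof -
  define base where "base t = base_point (c * t ^ 6)" for t
  define W where "W = U \<inter> {t. 1 + c * t ^ 6 \<noteq> 0}"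
  have "open W" "t \<in> W"
    unfolding W_def using assms by (auto intro!: open_Int open_Collect_neq continuous_intros)
  moreover have "continuous_on W base"
    unfolding base_def W_def
    by (intro continuous_at_imp_continuous_on ballI isCont_base_point) simp
  moreover have deriv: "DERIV base t :> 12 * c * t ^ 5 / (1 + c * t ^ 6)\<^sup>2"
    unfolding base_def base_point_def using assms(3)
    by (auto intro!: derivative_eq_intros simp: power2_eq_square)
  ultimately have "base t \<in> interior (base ` W)"
    using assms(1-3) by (intro DERIV_nonzero_imp_interior_image[OF _ _ _ deriv]) auto
  moreover have "base t \<in> closure {m. tangent_step\<^sup>*\<^sup>* m q}"
    by (simp add: tangent_orbit_preimages_dense)
  ultimately obtain m where "m \<in> interior (base ` W)" "tangent_step\<^sup>*\<^sup>* m q"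
    using open_Int_closure_eq_empty[OF open_interior, of "base ` W" "{m. tangent_step\<^sup>*\<^sup>* m q}"]
    by blast
  then show ?thesis
    using that interior_subset unfolding W_def base_def by blast
qed

lemma base_point_orbits_dense:
  fixes c t q :: real
  assumes "c \<noteq> 0" "t \<noteq> 0" "1 + c * t ^ 6 \<noteq> 0"
  shows "(t, q) \<in> closure {(t, m). t \<in> \<rat> \<and> tangent_step\<^sup>*\<^sup>* (base_point (c * t ^ 6)) m}"
    (is "_ \<in> closure ?A")
proof -
  have "?A \<inter> S \<noteq> {}" if S: "open S" "(t, q) \<in> S" for S
  proof -
    from open_prod_elim[OF S]
    obtain U V where UV: "open U" "open V" "(t, q) \<in> U \<times> V" "U \<times> V \<subseteq> S" .
    then have "t \<in> U" "q \<in> V"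
      by simp_all
    then obtain s where s: "s \<in> U" "1 + c * s ^ 6 \<noteq> 0"
      "tangent_step\<^sup>*\<^sup>* (base_point (c * s ^ 6)) q"
      using base_point_orbit_hits[OF assms \<open>open U\<close>] by blast
    have "filterlim (\<lambda>t. base_point (c * t ^ 6)) (nhds (base_point (c * s ^ 6))) (nhds s)"
      using isCont_base_point[OF s(2)] unfolding isCont_def
      by (rule tendsto_at_iff_tendsto_nhds[THEN iffD1])
    with eventually_tangent_orbit_meets[OF s(3) \<open>open V\<close> \<open>q \<in> V\<close>]
    have "\<forall>\<^sub>F t in nhds s. \<exists>m\<in>V. tangent_step\<^sup>*\<^sup>* (base_point (c * t ^ 6)) m"
      by (rule eventually_compose_filterlim)
    then obtain T where T: "open T" "s \<in> T"
      "\<And>t. t \<in> T \<Longrightarrow> \<exists>m\<in>V. tangent_step\<^sup>*\<^sup>* (base_point (c * t ^ 6)) m"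
      unfolding eventually_nhds by blast
    have "open (T \<inter> U)" "T \<inter> U \<noteq> {}"
      using T UV(1) s(1) by auto
    then obtain r where "r \<in> T" "r \<in> U" "r \<in> \<rat>"
      using open_Int_closure_eq_empty[of "T \<inter> U" \<rat>] by (auto simp: Rats_closure_real)
    with T(3) UV(4) show ?thesis
      by blast
  qed
  then show ?thesis
    unfolding closure_iff_nhds_not_empty by blast
qed

section \<open>Density of the rational points\<close>

definition rational_cone :: "int \<Rightarrow> int \<Rightarrow> real4 set" where
  "rational_cone a b = real4_of_rat ` {r. solves_eqn a b r}"

lemma rational_coneI:
  assumes "solves_eqn a b (x, y, z, w)" "x \<in> \<rat>" "y \<in> \<rat>" "z \<in> \<rat>" "w \<in> \<rat>"
  shows "(x, y, z, w) \<in> rational_cone a b"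
proof -
  obtain x' y' z' w' where "x = of_rat x'" "y = of_rat y'" "z = of_rat z'" "w = of_rat w'"
    using assms(2-5) by (auto elim!: Rats_cases)
  then have "(x, y, z, w) = real4_of_rat (x', y', z', w')"
    by (simp add: real4_of_rat_def)
  then show ?thesis
    using assms(1) by (auto simp: rational_cone_def solves_eqn_real4_of_rat)
qed

lemma trivial_solution_in_closure:
  assumes "a \<noteq> 0" "b \<noteq> 0" "trivial_sol a b v"
  shows "v \<in> closure (rational_cone a b)"
proof -
  obtain x y z w where v: "v = (x, y, z, w)"
    by (cases v)
  have "x\<^sup>2 = (y ^ 3)\<^sup>2" "z ^ 6 = w ^ 6"
    using assms by (simp_all add: v trivial_sol_def)
  then have "\<bar>x\<bar> = \<bar>y ^ 3\<bar>" "\<bar>z\<bar> = \<bar>w\<bar>"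
    by (simp_all only: power_eq_iff_abs_eq even_numeral zero_less_numeral)
  moreover have "\<exists>r\<in>{1, -1}. u = r * v" if "\<bar>u\<bar> = \<bar>v\<bar>" for u v :: real
    using that by (auto simp: abs_eq_iff)
  ultimately obtain r s where signs: "r \<in> {1, -1}" "s \<in> {1, -1}" "x = r * y ^ 3" "z = s * w"
    by meson
  define f where "f = (\<lambda>(y, w). (r * y ^ 3, y, s * w, w))"
  have "f (y, w) \<in> closure (rational_cone a b)" if "y \<in> \<rat>" "w \<in> \<rat>" for y w
  proof -
    have "r \<in> \<rat>" "s \<in> \<rat>" "r ^ 2 = 1" "s ^ 6 = 1"
      using signs(1,2) by auto
    then have "f (y, w) \<in> rational_cone a b"
      unfolding f_def split using that
      by (intro rational_coneI) (simp_all add: solves_eqn_def power_mult_distrib flip: power_mult)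
    then show ?thesis
      by (rule subsetD[OF closure_subset])
  qed
  then have "f ` closure (\<rat> \<times> \<rat>) \<subseteq> closure (rational_cone a b)"
    unfolding f_def case_prod_unfold
    by (intro image_closure_subset continuous_intros closed_closure) auto
  then show ?thesis
    by (auto simp: closure_Times Rats_closure_real v f_def signs)
qed

definition fibre_point :: "real \<Rightarrow> real \<Rightarrow> real \<Rightarrow> real \<Rightarrow> real4" where
  "fibre_point c t z w =
    (let A = c * t ^ 3 * (z ^ 3 - w ^ 3); B = (z ^ 3 + w ^ 3) / t ^ 3
     in ((A + B) / 2, root 3 ((B - A) / 2), z, w))"

lemma solves_eqn_fibre_point:
  assumes "a \<noteq> 0" "t \<noteq> 0"
  shows "solves_eqn a b (fibre_point (of_int b / of_int a) t z w)"
proof -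
  define A where "A = of_int b / of_int a * t ^ 3 * (z ^ 3 - w ^ 3)"
  define B where "B = (z ^ 3 + w ^ 3) / t ^ 3"
  have cube: "root 3 ((B - A) / 2) ^ 3 = (B - A) / 2"
    by (simp add: odd_real_root_pow)
  have "of_int a * A = of_int b * t ^ 3 * (z ^ 3 - w ^ 3)" "t ^ 3 * B = z ^ 3 + w ^ 3"
    using assms by (simp_all add: A_def B_def)
  moreover have "(A + B) / 2 - (B - A) / 2 = A" "(A + B) / 2 + (B - A) / 2 = B"
    by (simp_all add: field_simps)
  ultimately have "solves_eqn a b ((A + B) / 2, root 3 ((B - A) / 2), z, w)"
    by (intro solves_eqn_if_on_fibre[where r = "t ^ 3"]) (simp_all only: cube)
  then show ?thesis
    by (simp add: fibre_point_def Let_def A_def B_def)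
qed

lemma nontrivial_solutionE:
  assumes "a \<noteq> 0" "b \<noteq> 0" "solves_eqn a b v" "\<not> trivial_sol a b v"
  obtains t z w where "t \<noteq> 0" "v = fibre_point (of_int b / of_int a) t z w"
proof -
  obtain x y z w where v: "v = (x, y, z, w)"
    by (cases v)
  define c :: real where "c = of_int b / of_int a"
  define A where "A = x - y ^ 3"
  define B where "B = x + y ^ 3"
  have c: "c \<noteq> 0" "of_int b = of_int a * c"
    using assms by (auto simp: c_def)
  have factor: "x\<^sup>2 - y ^ 6 = A * B" "z ^ 6 - w ^ 6 = (z ^ 3 - w ^ 3) * (z ^ 3 + w ^ 3)"
    unfolding A_def B_def by algebra+
  have prod: "A * B = c * (z ^ 3 - w ^ 3) * (z ^ 3 + w ^ 3)"
    using assms(1,3) by (simp add: v solves_eqn_def factor c(2) mult.assoc)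
  have "A \<noteq> 0" "z ^ 3 - w ^ 3 \<noteq> 0"
    using assms(3,4) unfolding v solves_eqn_def trivial_sol_def split factor by auto
  define t where "t = root 3 (A / (c * (z ^ 3 - w ^ 3)))"
  have t3: "t ^ 3 = A / (c * (z ^ 3 - w ^ 3))"
    by (simp add: t_def odd_real_root_pow)
  have "t \<noteq> 0"
    using \<open>A \<noteq> 0\<close> \<open>z ^ 3 - w ^ 3 \<noteq> 0\<close> c(1) by (simp add: t_def)
  have "c * t ^ 3 * (z ^ 3 - w ^ 3) = A"
    using \<open>z ^ 3 - w ^ 3 \<noteq> 0\<close> c(1) by (simp add: t3)
  moreover have "(z ^ 3 + w ^ 3) / t ^ 3 = B"
    using \<open>A \<noteq> 0\<close> prod by (simp add: t3 field_simps)
  ultimately have "fibre_point c t z w = ((A + B) / 2, root 3 ((B - A) / 2), z, w)"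
    by (simp add: fibre_point_def Let_def)
  also have "\<dots> = v"
    by (simp add: v A_def B_def odd_real_root_power_cancel)
  finally show ?thesis
    using that[OF \<open>t \<noteq> 0\<close>] unfolding c_def by metis
qed

lemma tendsto_fibre_point:
  assumes "(T \<longlongrightarrow> t) F" "(Z \<longlongrightarrow> z) F" "(W \<longlongrightarrow> w) F" "t \<noteq> 0"
  shows "((\<lambda>i. fibre_point c (T i) (Z i) (W i)) \<longlongrightarrow> fibre_point c t z w) F"
  unfolding fibre_point_def Let_def using assms by (intro tendsto_intros) auto

lemma rational_fibre_point:
  fixes a b :: int and t w X Y :: real
  defines "c \<equiv> of_int b / of_int a"
  assumes "a \<noteq> 0" "t \<noteq> 0" "t \<in> \<rat>" "w \<in> \<rat>" "X \<in> \<rat>" "Y \<in> \<rat>"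
    and cubic: "2 * X ^ 3 = (1 - c * t ^ 6) * Y ^ 3 + (1 + c * t ^ 6)"
  shows "fibre_point c t (Y * w) w \<in> rational_cone a b"
proof -
  have "c \<in> \<rat>"
    by (simp add: c_def)
  define A where "A = c * t ^ 3 * ((Y * w) ^ 3 - w ^ 3)"
  define B where "B = ((Y * w) ^ 3 + w ^ 3) / t ^ 3"
  have "(B - A) * t ^ 3 = ((1 - c * t ^ 6) * Y ^ 3 + (1 + c * t ^ 6)) * w ^ 3"
    using \<open>t \<noteq> 0\<close> unfolding B_def A_def left_diff_distrib by (simp, algebra)
  then have "(B - A) / 2 = (X * w / t) ^ 3"
    using \<open>t \<noteq> 0\<close> unfolding cubic[symmetric] by (simp add: field_simps)
  then have "root 3 ((B - A) / 2) = X * w / t"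
    by (simp add: odd_real_root_power_cancel)
  then have "fibre_point c t (Y * w) w = ((A + B) / 2, X * w / t, Y * w, w)"
    by (simp add: fibre_point_def Let_def A_def B_def)
  moreover have "solves_eqn a b (fibre_point c t (Y * w) w)"
    using solves_eqn_fibre_point[OF \<open>a \<noteq> 0\<close> \<open>t \<noteq> 0\<close>] by (simp add: c_def)
  ultimately show ?thesis
    using assms(4-7) \<open>c \<in> \<rat>\<close> by (simp add: rational_coneI A_def B_def)
qed

definition cubic_ordinate :: "real \<Rightarrow> real \<Rightarrow> real" where
  "cubic_ordinate N m = root 3 (- (1 + m) * (1 + N) / (1 - N))"

lemma cubic_ordinate_eqI:
  assumes "1 - N \<noteq> 0" "(1 - N) * Y ^ 3 = - (1 + m) * (1 + N)"
  shows "cubic_ordinate N m = Y"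
proof -
  have "- (1 + m) * (1 + N) / (1 - N) = Y ^ 3"
    unfolding assms(2)[symmetric] using assms(1) by simp
  then show ?thesis
    by (simp only: cubic_ordinate_def) (simp add: odd_real_root_power_cancel)
qed

lemma tangent_orbit_fibre_point:
  fixes a b :: int and t w m :: real
  defines "c \<equiv> of_int b / of_int a"
  assumes "a \<noteq> 0" "t \<noteq> 0" "t \<in> \<rat>" "w \<in> \<rat>" and N: "1 + c * t ^ 6 \<noteq> 0" "1 - c * t ^ 6 \<noteq> 0"
    and orbit: "tangent_step\<^sup>*\<^sup>* (base_point (c * t ^ 6)) m"
  shows "fibre_point c t (cubic_ordinate (c * t ^ 6) m * w) w \<in> rational_cone a b"
proof -
  have "c * t ^ 6 \<in> \<rat>"
    using \<open>t \<in> \<rat>\<close> by (simp add: c_def)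
  with orbit have "rational_coordinate (c * t ^ 6) m"
    using N(1) by (rule rational_coordinate_tangent_orbit)
  then obtain X Y where XY: "X \<in> \<rat>" "Y \<in> \<rat>"
    and cubic: "2 * X ^ 3 = (1 - c * t ^ 6) * Y ^ 3 + (1 + c * t ^ 6)"
    and m: "(1 + c * t ^ 6) * m = - 2 * X ^ 3"
    unfolding rational_coordinate_def by blast
  have "(1 - c * t ^ 6) * Y ^ 3 = - (1 + m) * (1 + c * t ^ 6)"
    using cubic m by algebra
  with N(2) have "cubic_ordinate (c * t ^ 6) m = Y"
    by (rule cubic_ordinate_eqI)
  then show ?thesis
    using rational_fibre_point[OF assms(2-5) XY, of b] cubic by (simp add: c_def)
qed

lemma generic_fibre_point_in_closure:
  fixes a b :: int and t z w :: real
  defines "c \<equiv> of_int b / of_int a"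
  assumes "a \<noteq> 0" "b \<noteq> 0" "t \<noteq> 0" "w \<noteq> 0" and N: "1 + c * t ^ 6 \<noteq> 0" "1 - c * t ^ 6 \<noteq> 0"
  shows "fibre_point c t z w \<in> closure (rational_cone a b)"
proof -
  define f where "f = (\<lambda>((t, m), w). fibre_point c t (cubic_ordinate (c * t ^ 6) m * w) w)"
  define A where "A = {(t, m). t \<in> \<rat> \<and> tangent_step\<^sup>*\<^sup>* (base_point (c * t ^ 6)) m}"
  define q where "q = - 1 - (1 - c * t ^ 6) * (z / w) ^ 3 / (1 + c * t ^ 6)"
  have "(1 - c * t ^ 6) * (z / w) ^ 3 = - (1 + q) * (1 + c * t ^ 6)"
    using N(1) by (simp add: q_def)
  with N(2) have "cubic_ordinate (c * t ^ 6) q = z / w"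
    by (rule cubic_ordinate_eqI)
  then have f: "f ((t, q), w) = fibre_point c t z w"
    using \<open>w \<noteq> 0\<close> by (simp add: f_def)
  have "(t, q) \<in> closure A"
    unfolding A_def using assms by (intro base_point_orbits_dense) (simp_all add: c_def)
  then have "((t, q), w) \<in> closure (A \<times> \<rat>)"
    by (simp add: closure_Times Rats_closure_real)
  moreover have "isCont f ((t, q), w)"
    unfolding isCont_def f_def cubic_ordinate_def case_prod_unfold using \<open>t \<noteq> 0\<close> N
    by (intro tendsto_fibre_point tendsto_intros) auto
  moreover define U where "U = {s. s \<noteq> 0 \<and> 1 + c * s ^ 6 \<noteq> 0 \<and> 1 - c * s ^ 6 \<noteq> 0}"
  have "open U"
    unfolding U_def by (intro open_Collect_conj open_Collect_neq continuous_intros)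
  then have "\<forall>\<^sub>F p in nhds ((t, q), w). p \<in> (U \<times> UNIV) \<times> UNIV"
    using \<open>t \<noteq> 0\<close> N by (intro eventually_nhds_in_open open_Times) (auto simp: U_def)
  then have "\<forall>\<^sub>F p in nhds ((t, q), w). p \<in> A \<times> \<rat> \<longrightarrow> f p \<in> rational_cone a b"
    by eventually_elim (use tangent_orbit_fibre_point[OF \<open>a \<noteq> 0\<close>, of _ _ b] in
        \<open>auto simp: f_def A_def U_def c_def\<close>)
  then have "\<forall>\<^sub>F p in nhds ((t, q), w). p \<in> A \<times> \<rat> \<longrightarrow> f p \<in> closure (rational_cone a b)"
    by eventually_elim (blast intro: subsetD[OF closure_subset])
  ultimately have "f ((t, q), w) \<in> closure (rational_cone a b)"
    using closed_closure by (intro isCont_closure_in_closed[of "((t, q), w)" "A \<times> \<rat>" f])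
  then show ?thesis
    by (simp add: f)
qed

lemma fibre_point_in_closure:
  fixes a b :: int and t z w :: real
  defines "c \<equiv> of_int b / of_int a"
  assumes "a \<noteq> 0" "b \<noteq> 0" "t \<noteq> 0"
  shows "fibre_point c t z w \<in> closure (rational_cone a b)"
proof -
  have nonzero: "fibre_point c t z w \<in> closure (rational_cone a b)" if "w \<noteq> 0" for w
  proof (rule Lim_in_closed_set[OF closed_closure])
    show "((\<lambda>s. fibre_point c s z w) \<longlongrightarrow> fibre_point c t z w) (at t)"
      using \<open>t \<noteq> 0\<close> by (intro tendsto_fibre_point tendsto_intros)
    have "\<forall>\<^sub>F s in at t. poly [:1, 0, 0, 0, 0, 0, c:] s \<noteq> 0"
      "\<forall>\<^sub>F s in at t. poly [:1, 0, 0, 0, 0, 0, - c:] s \<noteq> 0"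
      by (intro eventually_at_poly_ne_0; simp)+
    moreover have "\<forall>\<^sub>F s in at t. s \<noteq> 0"
      by (rule eventually_neq_at_within)
    ultimately show "\<forall>\<^sub>F s in at t. fibre_point c s z w \<in> closure (rational_cone a b)"
    proof eventually_elim
      case (elim s)
      then have "1 + c * s ^ 6 \<noteq> 0" "1 - c * s ^ 6 \<noteq> 0"
        by (simp_all add: eval_nat_numeral algebra_simps)
      then show ?case
        using generic_fibre_point_in_closure[OF assms(2,3) elim(3) \<open>w \<noteq> 0\<close>] by (simp add: c_def)
    qed
  qed simp
  show ?thesis
  proof (rule Lim_in_closed_set[OF closed_closure])
    show "((\<lambda>v. fibre_point c t z v) \<longlongrightarrow> fibre_point c t z w) (at w)"
      using \<open>t \<noteq> 0\<close> by (intro tendsto_fibre_point tendsto_intros)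
    have "\<forall>\<^sub>F v in at w. v \<noteq> 0"
      by (rule eventually_neq_at_within)
    then show "\<forall>\<^sub>F v in at w. fibre_point c t z v \<in> closure (rational_cone a b)"
      by eventually_elim (rule nonzero)
  qed simp
qed

lemma solution_in_closure:
  assumes "a \<noteq> 0" "b \<noteq> 0" "solves_eqn a b v"
  shows "v \<in> closure (rational_cone a b)"
proof (cases "trivial_sol a b v")
  case True
  with assms(1,2) show ?thesis
    by (rule trivial_solution_in_closure)
next
  case False
  with assms obtain t z w where "t \<noteq> 0" "v = fibre_point (of_int b / of_int a) t z w"
    by (rule nontrivial_solutionE)
  then show ?thesis
    using fibre_point_in_closure[OF assms(1,2)] by simp
qed

lemma rational_points_dense:
  assumes "a \<noteq> 0" "b \<noteq> 0"
  shows "subtopology wproj_topology (real_points a b) closure_of rational_points a b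
    = real_points a b"
  unfolding dense_iff_dense_cone rational_cone_def[symmetric]
  using solution_in_closure[OF assms] by blast

theorem theorem2p1:
  fixes a b :: int
  assumes "a \<noteq> 0" and "b \<noteq> 0"
  shows "infinite {(x :: int poly, y :: int poly, z :: int poly, w :: int poly).
           solves_eqn a b (x, y, z, w) \<and> \<not> trivial_sol a b (x, y, z, w) \<and>
           gcd x (gcd y (gcd z w)) = 1}
       \<and> subtopology wproj_topology (real_points a b) closure_of rational_points a b
           = real_points a b"
  using infinite_coprime_polynomial_solutions[OF assms] rational_points_dense[OF assms]
  by (rule conjI)

end
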